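(* Let $\mathcal X,\mathcal Y$ be Hilbert spaces and let $(C,\mathbf A)$, with $C\in\mathcal L(\mathcal X,\mathcal Y)$ and $\mathbf A=(A_1,\dots,A_d)$, $A_j\in\mathcal L(\mathcal X)$, be a contractive output pair. Then there exist a Hilbert space $\mathcal U$ and an $S\in\mathcal S_{nc,d}(\mathcal U,\mathcal Y)$ such that $$K_S(z,w)=K_{C,\mathbf A}(z,w).$$
   Context: $\mathcal L(\mathcal U,\mathcal Y)$ denotes the bounded linear operators between Hilbert spaces. $d\ge1$ is a fixed integer and $\mathcal F_d$ is the free semigroup with unit generated by the letters $\{1,\dots,d\}$: words $\alpha=i_N\cdots i_1$, product given by concatenation, unit the empty word $\emptyset$; $\alpha^\top=i_1\cdots i_N$. $z^\alpha=z_{i_N}\cdots z_{i_1}$, $z^\emptyset=1$; $\mathbf A^\alpha=A_{i_N}\cdots A_{i_1}$, $\mathbf A^\emptyset=I$. $z=(z_1,\dots,z_d)$ and $w=(w_1,\dots,w_d)$ are two sets of indeterminates, noncommuting within each set; each $z_i$ commutes with each $w_j$, and indeterminates commute with operator coefficients. Products of formal power series are given by convolution. If $S(z)=\sum_\alpha s_\alpha z^\alpha$ then $S(w)^*=\sum_\alpha s_\alpha^*w^{\alpha^\top}$. $H^2_{\mathcal Y}(\mathcal F_d)=\{f=\sum_\alpha f_\alpha z^\alpha:\ f_\alpha\in\mathcal Y,\ \|f\|^2=\sum_\alpha\|f_\alpha\|^2<\infty\}$. The noncommutative Schur class $\mathcal S_{nc,d}(\mathcal U,\mathcal Y)$ is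 the set of formal power series $S(z)=\sum_\alpha s_\alpha z^\alpha$, $s_\alpha\in\mathcal L(\mathcal U,\mathcal Y)$, for which $M_S:f(z)\mapsto S(z)f(z)$ is a contraction from $H^2_{\mathcal U}(\mathcal F_d)$ into $H^2_{\mathcal Y}(\mathcal F_d)$. For such $S$, $K_S(z,w)=k_{\rm Sz}(z,w)I_{\mathcal Y}-S(z)k_{\rm Sz}(z,w)S(w)^*$ where $k_{\rm Sz}(z,w)=\sum_{\alpha}z^\alpha w^{\alpha^\top}$. An output pair $(C,\mathbf A)$ is contractive if $A_1^*A_1+\cdots+A_d^*A_d+C^*C\le I_{\mathcal X}$. With $A$ the column of $A_1,\dots,A_d$, $Z(z)=\begin{bmatrix}z_1I_{\mathcal X}&\cdots&z_dI_{\mathcal X}\end{bmatrix}$ and $Z(w)^*$ the column with entries $w_1I_{\mathcal X},\dots,w_dI_{\mathcal X}$, $$K_{C,\mathbf A}(z,w)=C(I-Z(z)A)^{-1}(I-A^*Z(w)^* )^{-1}C^*=\sum_{v,v'\in\mathcal F_d}C\mathbf A^v(\mathbf A^{v'})^*C^*z^vw^{v'^\top}.$$ *)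

theory Defs
  imports "HOL-Analysis.Analysis"
begin

text \<open>
  Complex Hilbert spaces. Norm and topology come from the underlying real inner product, which is
  the real part of \<open>cinner\<close>; \<open>cinner\<close> is linear in its first argument.
\<close>

class chilbert_space = real_inner + complete_space +
  fixes scaleC :: "complex \<Rightarrow> 'a \<Rightarrow> 'a" (infixr "*\<^sub>C" 75)
    and cinner :: "'a \<Rightarrow> 'a \<Rightarrow> complex"
  assumes scaleC_add_right: "c *\<^sub>C (x + y) = c *\<^sub>C x + c *\<^sub>C y"
    and scaleC_add_left: "(b + c) *\<^sub>C x = b *\<^sub>C x + c *\<^sub>C x"
    and scaleC_scaleC: "b *\<^sub>C c *\<^sub>C x = (b * c) *\<^sub>C x"
    and scaleR_scaleC: "r *\<^sub>R x = complex_of_real r *\<^sub>C x"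
    and cinner_commute: "cinner x y = cnj (cinner y x)"
    and cinner_add_left: "cinner (x + y) z = cinner x z + cinner y z"
    and cinner_scaleC_left: "cinner (c *\<^sub>C x) y = c * cinner x y"
    and inner_eq_Re_cinner: "inner x y = Re (cinner x y)"

instantiation prod :: (chilbert_space, chilbert_space) chilbert_space
begin

definition "c *\<^sub>C p = (c *\<^sub>C fst p, c *\<^sub>C snd p)"
definition "cinner p q = cinner (fst p) (fst q) + cinner (snd p) (snd q)"

instance
proof
  fix x y :: "'a \<times> 'b"
  show "cinner x y = cnj (cinner y x)"
    using cinner_commute[of "fst x" "fst y"] cinner_commute[of "snd x" "snd y"]
    by (simp add: cinner_prod_def)
qed (auto simp: scaleC_prod_def cinner_prod_def scaleC_add_right scaleC_add_left scaleC_scaleC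
    scaleR_scaleC cinner_add_left cinner_scaleC_left inner_prod_def inner_eq_Re_cinner
    scaleR_prod_def algebra_simps)

end

instantiation vec :: (chilbert_space, finite) chilbert_space
begin

definition "c *\<^sub>C v = (\<chi> i. c *\<^sub>C (v $ i))"
definition "cinner v w = (\<Sum>i\<in>UNIV. cinner (v $ i) (w $ i))"

instance
proof
  fix x y :: "'a ^ 'b"
  have "cinner (x $ i) (y $ i) = cnj (cinner (y $ i) (x $ i))" for i
    by (rule cinner_commute)
  then show "cinner x y = cnj (cinner y x)"
    by (simp add: cinner_vec_def)
qed (simp_all add: vec_eq_iff scaleC_vec_def cinner_vec_def scaleC_add_right scaleC_add_left
    scaleC_scaleC scaleR_scaleC cinner_add_left cinner_scaleC_left inner_vec_def
    inner_eq_Re_cinner sum.distrib sum_distrib_left)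

end

text \<open>
  A closed complex subspace of a Hilbert space is itself a Hilbert space; this is how Hilbert
  spaces occurring under an existential quantifier are represented.
\<close>

definition closed_csubspace :: "'u::chilbert_space set \<Rightarrow> bool" where
  "closed_csubspace U \<longleftrightarrow> closed U \<and> 0 \<in> U \<and> (\<forall>x\<in>U. \<forall>y\<in>U. x + y \<in> U) \<and> (\<forall>c. \<forall>x\<in>U. c *\<^sub>C x \<in> U)"

definition bounded_clinear_on :: "'u::chilbert_space set \<Rightarrow> ('u \<Rightarrow> 'y::chilbert_space) \<Rightarrow> bool" where
  "bounded_clinear_on U T \<longleftrightarrow>
     (\<forall>x\<in>U. \<forall>y\<in>U. T (x + y) = T x + T y) \<and> (\<forall>c. \<forall>x\<in>U. T (c *\<^sub>C x) = c *\<^sub>C T x) \<and>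
     (\<exists>B. \<forall>x\<in>U. norm (T x) \<le> B * norm x)"

abbreviation bounded_clinear :: "('x::chilbert_space \<Rightarrow> 'y::chilbert_space) \<Rightarrow> bool" where
  "bounded_clinear \<equiv> bounded_clinear_on UNIV"

text \<open>The adjoint of \<open>T : U \<rightarrow> Y\<close>, with values in \<open>U\<close>.\<close>

definition cadjoint_on ::
    "'u::chilbert_space set \<Rightarrow> ('u \<Rightarrow> 'y::chilbert_space) \<Rightarrow> 'y \<Rightarrow> 'u" where
  "cadjoint_on U T y = (THE x. x \<in> U \<and> (\<forall>u\<in>U. cinner (T u) y = cinner u x))"

abbreviation cadjoint :: "('x::chilbert_space \<Rightarrow> 'y::chilbert_space) \<Rightarrow> 'y \<Rightarrow> 'x" where
  "cadjoint \<equiv> cadjoint_on UNIV"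

definition loewner_le :: "('x::chilbert_space \<Rightarrow> 'x) \<Rightarrow> ('x \<Rightarrow> 'x) \<Rightarrow> bool" where
  "loewner_le P Q \<longleftrightarrow> (\<forall>x. cinner (Q x - P x) x \<in> \<real>\<^sub>\<ge>\<^sub>0)"

text \<open>
  The letters are the elements of a finite type \<open>'d\<close>. The word \<open>i\<^sub>N \<dots> i\<^sub>1\<close> is the list
  \<open>[i\<^sub>N, \<dots>, i\<^sub>1]\<close>, so its transpose is its reversal. A formal power series is its
  coefficient function; in a series \<open>F\<close> in \<open>z\<close> and \<open>w\<close>, the coefficient of \<open>z\<^sup>\<alpha> w\<^sup>\<beta>\<close> is
  \<open>F \<alpha> \<beta>\<close>.
\<close>

type_synonym 'd word = "'d list"

lemma finite_word_splits: "finite {(\<beta>, \<gamma>). \<beta> @ \<gamma> = (\<alpha> :: 'd word)}"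
proof (rule finite_subset)
  show "{(\<beta>, \<gamma>). \<beta> @ \<gamma> = \<alpha>} \<subseteq> (\<lambda>n. (take n \<alpha>, drop n \<alpha>)) ` {..length \<alpha>}"
  proof (clarify)
    fix \<beta> \<gamma> :: "'d word"
    show "(\<beta>, \<gamma>) \<in> (\<lambda>n. (take n (\<beta> @ \<gamma>), drop n (\<beta> @ \<gamma>))) ` {..length (\<beta> @ \<gamma>)}"
      by (rule image_eqI[of _ _ "length \<beta>"]) auto
  qed
qed simp

definition op_power :: "('d \<Rightarrow> 'x \<Rightarrow> 'x) \<Rightarrow> 'd word \<Rightarrow> 'x \<Rightarrow> 'x" where
  "op_power A \<alpha> = foldr (\<lambda>i T. A i \<circ> T) \<alpha> id"

definition series_apply ::
    "('d word \<Rightarrow> 'u \<Rightarrow> 'y::comm_monoid_add) \<Rightarrow> ('d word \<Rightarrow> 'u) \<Rightarrow> 'd word \<Rightarrow> 'y" where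
  "series_apply S f \<alpha> = (\<Sum>(\<beta>, \<gamma>) | \<beta> @ \<gamma> = \<alpha>. S \<beta> (f \<gamma>))"

definition series2_mult ::
    "('d word \<Rightarrow> 'd word \<Rightarrow> 'v \<Rightarrow> 'y::comm_monoid_add) \<Rightarrow> ('d word \<Rightarrow> 'd word \<Rightarrow> 'u \<Rightarrow> 'v) \<Rightarrow>
     'd word \<Rightarrow> 'd word \<Rightarrow> 'u \<Rightarrow> 'y" where
  "series2_mult F G \<alpha> \<beta> x =
     (\<Sum>(\<alpha>1, \<alpha>2) | \<alpha>1 @ \<alpha>2 = \<alpha>. \<Sum>(\<beta>1, \<beta>2) | \<beta>1 @ \<beta>2 = \<beta>. F \<alpha>1 \<beta>1 (G \<alpha>2 \<beta>2 x))"

definition H2 :: "'u::chilbert_space set \<Rightarrow> ('d::finite word \<Rightarrow> 'u) set" where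
  "H2 U = {f. (\<forall>\<alpha>. f \<alpha> \<in> U) \<and> (\<lambda>\<alpha>. (norm (f \<alpha>))\<^sup>2) summable_on UNIV}"

definition H2_norm :: "('d::finite word \<Rightarrow> 'u::chilbert_space) \<Rightarrow> real" where
  "H2_norm f = sqrt (\<Sum>\<^sub>\<infinity>\<alpha>. (norm (f \<alpha>))\<^sup>2)"

definition schur_class ::
    "'u::chilbert_space set \<Rightarrow> ('d::finite word \<Rightarrow> 'u \<Rightarrow> 'y::chilbert_space) set" where
  "schur_class U = {S. (\<forall>\<alpha>. bounded_clinear_on U (S \<alpha>)) \<and>
     (\<forall>f\<in>H2 U. series_apply S f \<in> H2 UNIV \<and> H2_norm (series_apply S f) \<le> H2_norm f)}"

text \<open>\<open>szego\<close> is \<open>k\<^sub>S\<^sub>z(z,w) I\<close>.\<close>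

definition szego :: "'d word \<Rightarrow> 'd word \<Rightarrow> 'v::zero \<Rightarrow> 'v" where
  "szego \<alpha> \<beta> x = (if \<beta> = rev \<alpha> then x else 0)"

text \<open>\<open>S(z)\<close> and \<open>S(w)\<^sup>*\<close>, as series in \<open>z\<close> and \<open>w\<close>; the latter has the coefficient
  \<open>s\<^sub>\<alpha>\<^sup>*\<close> at \<open>w\<^bsup>rev \<alpha>\<^esup>\<close>.\<close>

definition in_z :: "('d word \<Rightarrow> 'u \<Rightarrow> 'y::zero) \<Rightarrow> 'd word \<Rightarrow> 'd word \<Rightarrow> 'u \<Rightarrow> 'y" where
  "in_z S \<alpha> \<beta> u = (if \<beta> = [] then S \<alpha> u else 0)"

definition adj_in_w ::
    "'u::chilbert_space set \<Rightarrow> ('d word \<Rightarrow> 'u \<Rightarrow> 'y::chilbert_space) \<Rightarrow>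
     'd word \<Rightarrow> 'd word \<Rightarrow> 'y \<Rightarrow> 'u" where
  "adj_in_w U S \<alpha> \<beta> y = (if \<alpha> = [] then cadjoint_on U (S (rev \<beta>)) y else 0)"

definition K_Schur ::
    "'u::chilbert_space set \<Rightarrow> ('d word \<Rightarrow> 'u \<Rightarrow> 'y::chilbert_space) \<Rightarrow>
     'd word \<Rightarrow> 'd word \<Rightarrow> 'y \<Rightarrow> 'y" where
  "K_Schur U S \<alpha> \<beta> y =
     szego \<alpha> \<beta> y - series2_mult (series2_mult (in_z S) szego) (adj_in_w U S) \<alpha> \<beta> y"

definition output_pair ::
    "('x::chilbert_space \<Rightarrow> 'y::chilbert_space) \<Rightarrow> ('d::finite \<Rightarrow> 'x \<Rightarrow> 'x) \<Rightarrow> bool" where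
  "output_pair C A \<longleftrightarrow> bounded_clinear C \<and> (\<forall>j. bounded_clinear (A j))"

definition contractive_pair ::
    "('x::chilbert_space \<Rightarrow> 'y::chilbert_space) \<Rightarrow> ('d::finite \<Rightarrow> 'x \<Rightarrow> 'x) \<Rightarrow> bool" where
  "contractive_pair C A \<longleftrightarrow> output_pair C A \<and>
     loewner_le (\<lambda>x. (\<Sum>j\<in>UNIV. cadjoint (A j) (A j x)) + cadjoint C (C x)) (\<lambda>x. x)"

text \<open>The coefficient \<open>C A\<^sup>v (A\<^bsup>v'\<^esup>)\<^sup>* C\<^sup>*\<close> belongs to \<open>z\<^sup>v w\<^bsup>rev v'\<^esup>\<close>.\<close>

definition K_output ::
    "('x::chilbert_space \<Rightarrow> 'y::chilbert_space) \<Rightarrow> ('d::finite \<Rightarrow> 'x \<Rightarrow> 'x) \<Rightarrow>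
     'd word \<Rightarrow> 'd word \<Rightarrow> 'y \<Rightarrow> 'y" where
  "K_output C A \<alpha> \<beta> y =
     C (op_power A \<alpha> (cadjoint (op_power A (rev \<beta>)) (cadjoint C y)))"

end

theory Submission imports Defs begin

text \<open>
  Write \<open>H\<close> for the direct sum of \<open>d\<close> copies of the state space and the output space, and
  \<open>V x = (A\<^sub>1 x, \<dots>, A\<^sub>d x, C x)\<close>, an operator into \<open>H\<close> (\<open>output_column\<close>). The pair is contractive
  exactly if \<open>V\<close> is a contraction. Then \<open>I - V V\<^sup>*\<close> is positive, and with \<open>T\<close> a selfadjoint square
  root of it, \<open>V V\<^sup>* + T T\<^sup>* = I\<close>: the row \<open>[V T]\<close> is a coisometry (\<open>coisometric_completion\<close>). Let
  \<open>B\<^sub>1, \<dots>, B\<^sub>d, D\<close> be the components of \<open>T\<close>. The series wanted is the transfer function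
  \<open>S(z) = D + C (I - Z(z) A)\<^sup>-\<^sup>1 Z(z) B\<close>, with input space \<open>H\<close> itself.

  For the kernel identity let \<open>R\<^sub>\<alpha> : H \<rightarrow> Y\<close> be the map \<open>(x, y) \<mapsto> C A\<^sup>\<beta> x\<^sub>j\<close> if \<open>\<alpha> = \<beta> j\<close>, and
  \<open>(x, y) \<mapsto> y\<close> if \<open>\<alpha>\<close> is empty (\<open>output_coeff\<close>). Then \<open>C A\<^sup>\<alpha> = R\<^sub>\<alpha> V\<close>, while
  \<open>S\<^sub>\<alpha> = R\<^sub>\<alpha> T\<close>, so the coisometry equation says
  \<open>S\<^sub>\<alpha> S\<^sub>\<gamma>\<^sup>* + C A\<^sup>\<alpha> (A\<^sup>\<gamma>)\<^sup>* C\<^sup>* = R\<^sub>\<alpha> R\<^sub>\<gamma>\<^sup>*\<close>.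
  The right-hand side is \<open>I\<close> if both words are empty, \<open>C A\<^sup>\<beta> (A\<^sup>\<delta>)\<^sup>* C\<^sup>*\<close> if \<open>\<alpha> = \<beta> j\<close> and
  \<open>\<gamma> = \<delta> j\<close> end in the same letter, and \<open>0\<close> otherwise. By cancelling common last letters, this
  determines the kernel of the pair from \<open>S\<close>, and the kernel of \<open>S\<close> satisfies the same recursion
  (\<open>K_Schur_eq_K_output\<close>).

  The multiplier \<open>M\<^sub>S\<close> is a contraction because an input \<open>f\<close> drives a system with states
  \<open>x\<^sub>\<emptyset> = 0\<close>, \<open>x\<^bsub>j\<alpha>\<^esub> = A\<^sub>j x\<^sub>\<alpha> + B\<^sub>j f\<^sub>\<alpha>\<close> and output \<open>(S f)\<^sub>\<alpha> = C x\<^sub>\<alpha> + D f\<^sub>\<alpha>\<close>. At every word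
  the vector of new states and output is \<open>V x\<^sub>\<alpha> + T f\<^sub>\<alpha>\<close>, and a coisometric row is contractive, so no
  energy is created; summing over words, the states telescope away (\<open>energy_dissipation\<close>).
\<close>

section \<open>Riesz representation and adjoints\<close>

text \<open>
  The representing vector minimizes the functional \<open>\<phi> u = \<parallel>u\<parallel>\<^sup>2 - 2 f u\<close>: by the parallelogram law a
  minimizing sequence is Cauchy, and at the minimum the derivative of \<open>\<phi>\<close> vanishes in every direction.
\<close>

lemma riesz_representation:
  fixes f :: "'a::{real_inner, complete_space} \<Rightarrow> real"
  assumes "bounded_linear f"
  shows "\<exists>x. \<forall>u. f u = inner u x"
proof -
  interpret bounded_linear f by fact
  obtain B where B: "\<And>u. \<bar>f u\<bar> \<le> norm u * B"
    using bounded by (auto simp: real_norm_def)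
  define \<phi> where "\<phi> u = (norm u)\<^sup>2 - 2 * f u" for u
  define m where "m = Inf (range \<phi>)"
  have low: "\<phi> u \<ge> - B\<^sup>2" for u
  proof -
    have "0 \<le> (norm u - B)\<^sup>2" by simp
    also have "\<dots> = (norm u)\<^sup>2 - 2 * (norm u * B) + B\<^sup>2" by (simp add: power2_diff)
    also have "\<dots> \<le> \<phi> u + B\<^sup>2" using B[of u] by (simp add: \<phi>_def abs_le_iff)
    finally show ?thesis by simp
  qed
  have bdd: "bdd_below (range \<phi>)" by (rule bdd_belowI[of _ "- B\<^sup>2"]) (auto simp: low)
  have m_le: "m \<le> \<phi> u" for u unfolding m_def using bdd by (intro cInf_lower) auto
  have "\<exists>u. \<phi> u < m + inverse (real (Suc n))" for n
    using cInf_lessD[of "range \<phi>" "m + inverse (real (Suc n))"] by (auto simp: m_def)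
  then obtain X where X: "\<And>n. \<phi> (X n) < m + inverse (real (Suc n))" by metis
  \<comment> \<open>The parallelogram law, with the midpoint estimated by the infimum.\<close>
  have par: "(norm (u - v))\<^sup>2 \<le> 2 * (\<phi> u + \<phi> v - 2 * m)" for u v
  proof -
    have "\<phi> u + \<phi> v = 2 * \<phi> ((1/2) *\<^sub>R (u + v)) + (norm (u - v))\<^sup>2 / 2"
      by (simp add: \<phi>_def power2_norm_eq_inner inner_simps scaleR add inner_commute[of v u] field_simps)
    then show ?thesis using m_le[of "(1/2) *\<^sub>R (u + v)"] by simp
  qed
  have "Cauchy X"
  proof (rule metric_CauchyI)
    fix e :: real assume "e > 0"
    then obtain M where M: "inverse (real (Suc M)) < e\<^sup>2 / 4"
      using reals_Archimedean[of "e\<^sup>2 / 4"] by auto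
    have "dist (X p) (X n) < e" if "p \<ge> M" "n \<ge> M" for p n
    proof -
      have small: "\<phi> (X k) < m + e\<^sup>2 / 4" if "k \<ge> M" for k
      proof -
        have "inverse (real (Suc k)) \<le> inverse (real (Suc M))"
          using that by (intro le_imp_inverse_le) auto
        then show ?thesis using X[of k] M by linarith
      qed
      have "(norm (X p - X n))\<^sup>2 < e\<^sup>2"
        using par[of "X p" "X n"] small[OF that(1)] small[OF that(2)] by argo
      then show ?thesis using \<open>e > 0\<close> by (simp add: dist_norm power_less_imp_less_base)
    qed
    then show "\<exists>M. \<forall>p\<ge>M. \<forall>n\<ge>M. dist (X p) (X n) < e" by blast
  qed
  then obtain x where x: "X \<longlonglongrightarrow> x" using Cauchy_convergent convergent_def by blast
  have "(\<lambda>n. \<phi> (X n)) \<longlonglongrightarrow> \<phi> x" unfolding \<phi>_def by (intro tendsto_intros tendsto x)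
  moreover have "(\<lambda>n. m + inverse (real (Suc n))) \<longlonglongrightarrow> m + 0"
    by (intro tendsto_intros LIMSEQ_inverse_real_of_nat)
  ultimately have "\<phi> x \<le> m + 0"
    using X by (intro LIMSEQ_le[of _ _ "\<lambda>n. m + inverse (real (Suc n))"]) (auto intro: less_imp_le)
  then have min: "\<phi> x \<le> \<phi> u" for u using m_le[of u] by simp
  have "f u = inner u x" for u
  proof (rule ccontr)
    assume ne: "f u \<noteq> inner u x"
    then have u: "u \<noteq> 0" by (auto simp: zero)
    define e where "e = f u - inner u x"
    \<comment> \<open>The minimizer of \<open>\<phi>\<close> on the line through \<open>x\<close> in direction \<open>u\<close> has parameter \<open>t\<close>.\<close>
    define t where "t = e / (norm u)\<^sup>2"
    have "\<phi> (x + t *\<^sub>R u) = \<phi> x + t\<^sup>2 * (norm u)\<^sup>2 - 2 * t * e"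
      by (simp add: \<phi>_def e_def power2_norm_eq_inner inner_simps scaleR add inner_commute[of x u]
          power2_eq_square[of t] algebra_simps)
    also have "\<dots> = \<phi> x - e\<^sup>2 / (norm u)\<^sup>2"
      using u by (simp add: t_def field_simps power2_eq_square)
    finally have "e\<^sup>2 / (norm u)\<^sup>2 \<le> 0" using min[of "x + t *\<^sub>R u"] by simp
    moreover have "e\<^sup>2 / (norm u)\<^sup>2 > 0" using u ne by (simp add: e_def)
    ultimately show False by simp
  qed
  then show ?thesis by blast
qed

instance chilbert_space \<subseteq> banach ..

lemma cinner_scaleC_right: "cinner x (c *\<^sub>C y) = cnj c * cinner x y"
  using cinner_commute[of x "c *\<^sub>C y"] cinner_commute[of x y] by (simp add: cinner_scaleC_left)

lemma cinner_add_right: "cinner x (y + z) = cinner x y + cinner x z"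
  using cinner_commute[of x "y + z"] cinner_commute[of x y] cinner_commute[of x z]
  by (simp add: cinner_add_left)

lemma cinner_zero_right: "cinner x 0 = 0"
  using cinner_add_right[of x 0 0] by simp

lemma norm_scaleC: "norm (c *\<^sub>C x) = cmod c * norm (x :: 'a::chilbert_space)"
proof (rule power2_eq_imp_eq)
  have "(norm (c *\<^sub>C x))\<^sup>2 = Re ((c * cnj c) * cinner x x)"
    by (simp add: power2_norm_eq_inner inner_eq_Re_cinner cinner_scaleC_left cinner_scaleC_right
        algebra_simps)
  also have "\<dots> = (cmod c * norm x)\<^sup>2"
    by (simp add: complex_norm_square[symmetric] power2_norm_eq_inner[of x] inner_eq_Re_cinner
        power_mult_distrib)
  finally show "(norm (c *\<^sub>C x))\<^sup>2 = (cmod c * norm x)\<^sup>2" .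
qed auto

lemma bounded_linear_scaleC: "bounded_linear (\<lambda>x::'a::chilbert_space. c *\<^sub>C x)"
proof (rule bounded_linear_intro[where K = "cmod c"])
  fix r and x :: 'a
  show "c *\<^sub>C (r *\<^sub>R x) = r *\<^sub>R (c *\<^sub>C x)"
    by (simp add: scaleR_scaleC scaleC_scaleC mult.commute)
qed (simp_all add: scaleC_add_right norm_scaleC)

lemma bounded_clinear_iff:
  "bounded_clinear T \<longleftrightarrow> bounded_linear T \<and> (\<forall>c x. T (c *\<^sub>C x) = c *\<^sub>C T x)"
proof safe
  assume T: "bounded_clinear T"
  then obtain B where "\<And>x. norm (T x) \<le> B * norm x" by (auto simp: bounded_clinear_on_def)
  then show "bounded_linear T"
    using T by (intro bounded_linear_intro[where K = B])
      (auto simp: bounded_clinear_on_def scaleR_scaleC mult.commute)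
next
  assume "bounded_linear T" and T: "\<forall>c x. T (c *\<^sub>C x) = c *\<^sub>C T x"
  then interpret bounded_linear T by simp
  obtain B where "\<And>x. norm (T x) \<le> norm x * B" using bounded by auto
  then show "bounded_clinear T" using T by (auto simp: bounded_clinear_on_def add mult.commute)
qed (auto simp: bounded_clinear_on_def)

lemma bounded_clinear_zero: "bounded_clinear T \<Longrightarrow> T 0 = 0"
  by (simp add: bounded_clinear_iff linear_0 bounded_linear.linear)

lemma bounded_clinear_compose:
  "bounded_clinear S \<Longrightarrow> bounded_clinear T \<Longrightarrow> bounded_clinear (\<lambda>x. S (T x))"
  by (simp add: bounded_clinear_iff bounded_linear_compose)

text \<open>
  The imaginary part of \<open>cinner u x\<close> is the real part of \<open>cinner (- \<i> u) x\<close>, so a complex-linear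
  operator has the same adjoint for \<open>inner\<close> as for \<open>cinner\<close>.
\<close>

lemma cinner_eq_if_inner_eq:
  assumes "\<And>u. inner (F u) y = inner u x" and "\<And>c u. F (c *\<^sub>C u) = c *\<^sub>C F u"
  shows "cinner (F u) y = cinner u x"
proof (rule complex_eqI)
  show "Re (cinner (F u) y) = Re (cinner u x)" using assms(1)[of u] by (simp add: inner_eq_Re_cinner)
  show "Im (cinner (F u) y) = Im (cinner u x)"
    using assms(1)[of "\<i> *\<^sub>C u"] by (simp add: assms(2) inner_eq_Re_cinner cinner_scaleC_left)
qed

lemma cadjoint_eqI:
  assumes "\<And>u. cinner (T u) y = cinner u x"
  shows "cadjoint T y = x"
  unfolding cadjoint_on_def
proof (rule the_equality)
  fix x' assume "x' \<in> UNIV \<and> (\<forall>u\<in>UNIV. cinner (T u) y = cinner u x')"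
  then have "inner u x' = inner u x" for u by (simp add: assms inner_eq_Re_cinner)
  then show "x' = x" by (metis inner_eq_zero_iff inner_diff_right right_minus_eq)
qed (simp add: assms)

lemma cinner_cadjoint:
  assumes T: "bounded_clinear T"
  shows "cinner (T u) y = cinner u (cadjoint T y)"
proof -
  have "bounded_linear T" using T by (simp add: bounded_clinear_iff)
  then have "bounded_linear (\<lambda>u. inner (T u) y)"
    by (intro bounded_linear_compose[OF bounded_linear_inner_left])
  then obtain x where "\<And>u. inner (T u) y = inner u x" using riesz_representation by blast
  then have x: "cinner (T u) y = cinner u x" for u
    using T by (intro cinner_eq_if_inner_eq) (auto simp: bounded_clinear_iff)
  then show ?thesis by (simp add: cadjoint_eqI[OF x])
qed

lemma inner_cadjoint: "bounded_clinear T \<Longrightarrow> inner (T u) y = inner u (cadjoint T y)"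
  by (simp add: inner_eq_Re_cinner cinner_cadjoint)

lemma cadjoint_compose:
  assumes "bounded_clinear S" "bounded_clinear T"
  shows "cadjoint (\<lambda>x. S (T x)) y = cadjoint T (cadjoint S y)"
  by (rule cadjoint_eqI) (simp add: assms cinner_cadjoint)

lemma norm_cadjoint_le:
  assumes T: "bounded_clinear T" and B: "\<And>x. norm (T x) \<le> norm x"
  shows "norm (cadjoint T y) \<le> norm y"
proof -
  let ?x = "cadjoint T y"
  have "(norm ?x)\<^sup>2 = inner (T ?x) y" by (simp add: power2_norm_eq_inner inner_cadjoint[OF T])
  also have "\<dots> \<le> norm (T ?x) * norm y" by (rule norm_cauchy_schwarz)
  also have "\<dots> \<le> norm ?x * norm y" by (intro mult_right_mono B) simp
  finally show ?thesis by (cases "?x = 0") (simp_all add: power2_eq_square)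
qed

lemma bounded_clinear_cadjoint:
  assumes T: "bounded_clinear T" and B: "\<And>x. norm (T x) \<le> norm x"
  shows "bounded_clinear (cadjoint T)"
proof -
  have "cadjoint T (y + z) = cadjoint T y + cadjoint T z" for y z
    by (rule cadjoint_eqI) (simp add: cinner_add_right cinner_cadjoint[OF T])
  moreover have "cadjoint T (c *\<^sub>C y) = c *\<^sub>C cadjoint T y" for c y
    by (rule cadjoint_eqI) (simp add: cinner_scaleC_right cinner_cadjoint[OF T])
  ultimately show ?thesis
    using norm_cadjoint_le[OF T B] by (auto simp: bounded_clinear_on_def intro: exI[of _ 1])
qed

section \<open>Square roots of the complement of a contraction\<close>

text \<open>
  The Taylor coefficients of \<open>sqrt (1 - x)\<close>. They are absolutely summable, so the series can be
  evaluated at any contraction on a Banach space.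
\<close>

definition sqrt_coeff :: "nat \<Rightarrow> real" where
  "sqrt_coeff n = (1/2 gchoose n) * (-1) ^ n"

lemma sqrt_coeff_Suc: "sqrt_coeff (Suc n) = sqrt_coeff n * (real n - 1/2) / real (Suc n)"
  by (simp add: sqrt_coeff_def gbinomial_prod_rev field_simps)

lemma sqrt_coeff_nonpos: "sqrt_coeff (Suc n) \<le> 0"
proof (induction n)
  case (Suc n)
  then show ?case
    by (subst sqrt_coeff_Suc) (intro divide_nonpos_pos mult_nonpos_nonneg, auto)
qed (simp add: sqrt_coeff_def)

text \<open>
  All coefficients but the first are nonpositive, and for \<open>0 \<le> x < 1\<close> the terms after the first sum
  to \<open>sqrt (1 - x) - 1 \<ge> -1\<close>. So the partial sums of their absolute values at \<open>x\<close> are at most \<open>1\<close>, and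
  letting \<open>x\<close> tend to \<open>1\<close> bounds those of the coefficients themselves.
\<close>

lemma sqrt_coeff_abs_summable: "(\<lambda>n. \<bar>sqrt_coeff n\<bar>) summable_on UNIV"
proof -
  have part: "(\<Sum>n<N. - sqrt_coeff (Suc n) * x ^ Suc n) \<le> 1" if x: "0 \<le> x" "x < 1" for x N
  proof -
    have "(\<lambda>n. (1/2 gchoose n) * (- x) ^ n) sums (1 + - x) powr (1/2)"
      using x by (intro gen_binomial_real) simp
    then have "(\<lambda>n. sqrt_coeff n * x ^ n) sums sqrt (1 - x)"
      using x by (simp add: sqrt_coeff_def powr_half_sqrt power_minus[of x] mult.assoc)
    then have "(\<lambda>n. sqrt_coeff (Suc n) * x ^ Suc n) sums (sqrt (1 - x) - 1)"
      by (subst sums_Suc_iff) (simp add: sqrt_coeff_def)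
    then have s: "(\<lambda>n. - sqrt_coeff (Suc n) * x ^ Suc n) sums (1 - sqrt (1 - x))"
      using sums_minus by fastforce
    have "(\<Sum>n<N. - sqrt_coeff (Suc n) * x ^ Suc n) \<le> (\<Sum>n. - sqrt_coeff (Suc n) * x ^ Suc n)"
      using s x sqrt_coeff_nonpos
      by (intro sum_le_suminf) (auto simp: sums_iff intro!: mult_nonpos_nonneg)
    also have "\<dots> \<le> 1" using s x by (simp add: sums_iff)
    finally show ?thesis .
  qed
  have "(\<Sum>n<N. \<bar>sqrt_coeff (Suc n)\<bar>) \<le> 1" for N
  proof (rule tendsto_upperbound)
    show "((\<lambda>x. \<Sum>n<N. - sqrt_coeff (Suc n) * x ^ Suc n) \<longlongrightarrow> (\<Sum>n<N. \<bar>sqrt_coeff (Suc n)\<bar>))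
            (at_left 1)"
      by (rule tendsto_eq_intros | simp add: sqrt_coeff_nonpos)+
    show "\<forall>\<^sub>F x in at_left 1. (\<Sum>n<N. - sqrt_coeff (Suc n) * x ^ Suc n) \<le> 1"
      unfolding eventually_at_left_field by (intro exI[of _ 0]) (use part in auto)
  qed simp
  then have "summable (\<lambda>n. \<bar>sqrt_coeff (Suc n)\<bar>)"
    by (intro summableI_nonneg_bounded[where x = 1]) auto
  then have "summable (\<lambda>n. norm (sqrt_coeff n))" by (simp add: summable_Suc_iff[of "\<lambda>n. \<bar>sqrt_coeff n\<bar>"])
  then show ?thesis
    using norm_summable_imp_summable_on[of "\<lambda>n. \<bar>sqrt_coeff n\<bar>"] by simp
qed

text \<open>
  The square of \<open>sqrt (1 - x)\<close> is \<open>1 - x\<close>, in terms of coefficients: Vandermonde's identity for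
  \<open>1/2 + 1/2 = 1\<close>.
\<close>

lemma sqrt_coeff_convolution:
  "(\<Sum>k\<le>n. sqrt_coeff k * sqrt_coeff (n - k)) = (if n = 0 then 1 else if n = 1 then -1 else 0)"
proof -
  have "(\<Sum>k\<le>n. sqrt_coeff k * sqrt_coeff (n - k))
      = (\<Sum>k\<in>{0..n}. (1/2 gchoose k) * (1/2 gchoose (n - k)) * (-1) ^ n)"
    by (rule sum.cong) (auto simp: sqrt_coeff_def power_add[symmetric])
  also have "\<dots> = ((1/2 + 1/2 :: real) gchoose n) * (-1) ^ n"
    by (simp add: sum_distrib_right[symmetric] gbinomial_Vandermonde)
  also have "(1/2 + 1/2 :: real) gchoose n = real (1 choose n)" by (simp add: binomial_gbinomial)
  finally have "(\<Sum>k\<le>n. sqrt_coeff k * sqrt_coeff (n - k)) = real (1 choose n) * (-1) ^ n" .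
  moreover have "n = 0 \<or> n = 1 \<or> n > 1" by linarith
  ultimately show ?thesis by (auto simp: binomial_eq_0)
qed

definition sqrt_compl :: "('a::banach \<Rightarrow> 'a) \<Rightarrow> 'a \<Rightarrow> 'a" where
  "sqrt_compl Q u = (\<Sum>\<^sub>\<infinity>n. sqrt_coeff n *\<^sub>R (Q ^^ n) u)"

context
  fixes Q :: "'a::banach \<Rightarrow> 'a"
  assumes lin: "bounded_linear Q" and contr: "\<And>u. norm (Q u) \<le> norm u"
begin

lemma norm_funpow_le: "norm ((Q ^^ n) u) \<le> norm u"
  proof (induction n)
  case (Suc n)
  then show ?case using contr[of "(Q ^^ n) u"] by simp
qed simp

lemma bounded_linear_funpow: "bounded_linear (Q ^^ n)"
proof (induction n)
  case (Suc n)
  then show ?case using bounded_linear_compose[OF lin] by (simp add: comp_def)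
qed (simp add: id_def)

lemma sqrt_compl_terms_summable: "(\<lambda>n. norm (sqrt_coeff n *\<^sub>R (Q ^^ n) u)) summable_on UNIV"
  by (rule Infinite_Sum.abs_summable_on_comparison_test'[where g = "\<lambda>n. \<bar>sqrt_coeff n\<bar> * norm u"])
     (auto intro!: summable_on_cmult_left sqrt_coeff_abs_summable mult_left_mono norm_funpow_le)

lemma sqrt_compl_has_sum: "((\<lambda>n. sqrt_coeff n *\<^sub>R (Q ^^ n) u) has_sum sqrt_compl Q u) UNIV"
  unfolding sqrt_compl_def
  by (rule has_sum_infsum[OF Infinite_Sum.abs_summable_summable[OF sqrt_compl_terms_summable]])

lemma bounded_linear_sqrt_compl: "bounded_linear (sqrt_compl Q)"
proof (rule bounded_linear_intro[where K = "\<Sum>\<^sub>\<infinity>n. \<bar>sqrt_coeff n\<bar>"])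
  fix u v :: 'a and r :: real
  interpret bounded_linear "Q ^^ n" for n by (rule bounded_linear_funpow)
  show "sqrt_compl Q (u + v) = sqrt_compl Q u + sqrt_compl Q v"
    using has_sum_add[OF sqrt_compl_has_sum[of u] sqrt_compl_has_sum[of v]]
    by (intro has_sum_unique[OF sqrt_compl_has_sum]) (simp add: add scaleR_add_right)
  show "sqrt_compl Q (r *\<^sub>R u) = r *\<^sub>R sqrt_compl Q u"
    using has_sum_bounded_linear[OF bounded_linear_scaleR_right sqrt_compl_has_sum, of r u]
    by (intro has_sum_unique[OF sqrt_compl_has_sum]) (simp add: scaleR mult.commute o_def)
  have "norm (sqrt_compl Q u) \<le> (\<Sum>\<^sub>\<infinity>n. \<bar>sqrt_coeff n\<bar>) * norm u"
    by (rule norm_infsum_le[OF sqrt_compl_has_sum has_sum_cmult_left[OF has_sum_infsum]])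
       (auto intro!: sqrt_coeff_abs_summable mult_left_mono norm_funpow_le)
  then show "norm (sqrt_compl Q u) \<le> norm u * (\<Sum>\<^sub>\<infinity>n. \<bar>sqrt_coeff n\<bar>)" by (simp add: mult.commute)
qed

lemma sqrt_compl_commute:
  assumes "bounded_linear L" and com: "\<And>u. L (Q u) = Q (L u)"
  shows "sqrt_compl Q (L u) = L (sqrt_compl Q u)"
proof -
  interpret L: bounded_linear L by fact
  have "L ((Q ^^ n) u) = (Q ^^ n) (L u)" for n by (induction n) (auto simp: com)
  then show ?thesis
    using has_sum_bounded_linear[OF assms(1) sqrt_compl_has_sum, of u]
    by (intro has_sum_unique[OF sqrt_compl_has_sum]) (simp add: L.scaleR o_def)
qed

text \<open>
  The Cauchy product of the series with itself. Absolute summability over all pairs \<open>(i, j)\<close> allows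
  the terms to be regrouped by \<open>n = i + j\<close>.
\<close>

lemma sqrt_compl_squared: "sqrt_compl Q (sqrt_compl Q u) = u - Q u"
proof -
  let ?g = "\<lambda>(i, j). (sqrt_coeff i * sqrt_coeff j) *\<^sub>R (Q ^^ (i + j)) u"
  have "(\<lambda>p. norm (case p of (i, j) \<Rightarrow> sqrt_coeff i * sqrt_coeff j)) summable_on UNIV \<times> UNIV"
    by (subst Infinite_Sum.abs_summable_on_Sigma_iff)
       (auto simp: abs_mult infsum_cmult_right' infsum_nonneg
          intro!: summable_on_cmult_right summable_on_cmult_left sqrt_coeff_abs_summable)
  then have "(\<lambda>p. norm (case p of (i, j) \<Rightarrow> sqrt_coeff i * sqrt_coeff j) * norm u) summable_on UNIV \<times> UNIV"
    by (rule summable_on_cmult_left)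
  then have "(\<lambda>p. norm (?g p)) summable_on UNIV \<times> UNIV"
    by (rule Infinite_Sum.abs_summable_on_comparison_test') (auto intro!: mult_left_mono norm_funpow_le)
  then have g: "?g summable_on UNIV \<times> UNIV" by (rule Infinite_Sum.abs_summable_summable)
  have row: "(\<Sum>\<^sub>\<infinity>j. ?g (i, j)) = sqrt_coeff i *\<^sub>R (Q ^^ i) (sqrt_compl Q u)" for i
  proof -
    interpret P: bounded_linear "Q ^^ i" by (rule bounded_linear_funpow)
    have "((\<lambda>j. sqrt_coeff i *\<^sub>R (Q ^^ i) (sqrt_coeff j *\<^sub>R (Q ^^ j) u)) has_sum
            sqrt_coeff i *\<^sub>R (Q ^^ i) (sqrt_compl Q u)) UNIV"
      using has_sum_bounded_linear[OF bounded_linear_compose[OF bounded_linear_scaleR_right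
            bounded_linear_funpow] sqrt_compl_has_sum] by (simp add: o_def)
    then show ?thesis by (intro infsumI) (simp add: P.scaleR funpow_add)
  qed
  have bij: "?g summable_on UNIV \<times> UNIV \<longleftrightarrow>
      (\<lambda>(n, k). (sqrt_coeff k * sqrt_coeff (n - k)) *\<^sub>R (Q ^^ n) u) summable_on Sigma UNIV atMost"
    by (rule summable_on_reindex_bij_witness[where i = "\<lambda>(n, k). (k, n - k)" and j = "\<lambda>(i, j). (i + j, i)"]) auto
  have "sqrt_compl Q (sqrt_compl Q u) = (\<Sum>\<^sub>\<infinity>i. \<Sum>\<^sub>\<infinity>j. ?g (i, j))"
    unfolding row by (simp add: sqrt_compl_def[of Q "sqrt_compl Q u"])
  also have "\<dots> = infsum ?g (UNIV \<times> UNIV)" using g by (intro infsum_Sigma_banach)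
  also have "\<dots> = infsum (\<lambda>(n, k). (sqrt_coeff k * sqrt_coeff (n - k)) *\<^sub>R (Q ^^ n) u) (Sigma UNIV atMost)"
    by (rule infsum_reindex_bij_witness[where i = "\<lambda>(n, k). (k, n - k)" and j = "\<lambda>(i, j). (i + j, i)"]) auto
  also have "\<dots> = (\<Sum>\<^sub>\<infinity>n. \<Sum>\<^sub>\<infinity>k\<in>{..n}. (sqrt_coeff k * sqrt_coeff (n - k)) *\<^sub>R (Q ^^ n) u)"
    using g bij by (subst infsum_Sigma_banach[symmetric]) auto
  also have "\<dots> = (\<Sum>\<^sub>\<infinity>n. (\<Sum>k\<le>n. sqrt_coeff k * sqrt_coeff (n - k)) *\<^sub>R (Q ^^ n) u)"
    by (simp add: scaleR_left.sum)
  also have "\<dots> = (\<Sum>\<^sub>\<infinity>n\<in>{0, 1}. (\<Sum>k\<le>n. sqrt_coeff k * sqrt_coeff (n - k)) *\<^sub>R (Q ^^ n) u)"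
    by (rule infsum_cong_neutral) (auto simp: sqrt_coeff_convolution)
  also have "\<dots> = u - Q u" by (simp add: sqrt_coeff_convolution del: sum.atMost_Suc)
  finally show ?thesis .
qed

end

lemma sqrt_compl_selfadjoint:
  fixes Q :: "'a::{real_inner, banach} \<Rightarrow> 'a"
  assumes lin: "bounded_linear Q" and contr: "\<And>u. norm (Q u) \<le> norm u"
    and sa: "\<And>u v. inner (Q u) v = inner u (Q v)"
  shows "inner (sqrt_compl Q u) v = inner u (sqrt_compl Q v)"
proof -
  have "inner ((Q ^^ n) u) v = inner u ((Q ^^ n) v)" for n
    by (induction n arbitrary: u v) (auto simp: sa funpow_swap1)
  then show ?thesis
    using has_sum_bounded_linear[OF bounded_linear_inner_left[of v] sqrt_compl_has_sum[OF lin contr, of u]]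
      has_sum_bounded_linear[OF bounded_linear_inner_right[of u] sqrt_compl_has_sum[OF lin contr, of v]]
    by (intro has_sum_unique[where x = "inner (sqrt_compl Q u) v"]) (auto simp: o_def)
qed

text \<open>
  Selfadjointness of the square root passes from \<open>V V\<^sup>*\<close> to the power series in it, so the square of
  \<open>T\<close> is \<open>T T\<^sup>*\<close>.
\<close>

lemma coisometric_completion:
  fixes V :: "'x::chilbert_space \<Rightarrow> 'h::chilbert_space"
  assumes V: "bounded_clinear V" and contr: "\<And>x. norm (V x) \<le> norm x"
  obtains T :: "'h \<Rightarrow> 'h"
    where "bounded_clinear T" "\<And>h. V (cadjoint V h) + T (cadjoint T h) = h"
proof
  define Q where "Q h = V (cadjoint V h)" for h
  have Q: "bounded_clinear Q"
    unfolding Q_def by (rule bounded_clinear_compose[OF V bounded_clinear_cadjoint[OF V contr]])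
  then have lin: "bounded_linear Q" and scale: "\<And>c h. Q (c *\<^sub>C h) = c *\<^sub>C Q h"
    by (auto simp: bounded_clinear_iff)
  have Q_le: "norm (Q h) \<le> norm h" for h
    unfolding Q_def using contr norm_cadjoint_le[OF V contr] by (rule order_trans)
  have sa: "inner (Q h) k = inner h (Q k)" for h k
    unfolding Q_def using inner_cadjoint[OF V, of "cadjoint V h" k]
      inner_cadjoint[OF V, of "cadjoint V k" h]
    by (simp add: inner_commute)
  let ?T = "sqrt_compl Q"
  have scale_T: "?T (c *\<^sub>C h) = c *\<^sub>C ?T h" for c h
    by (rule sqrt_compl_commute[OF lin Q_le bounded_linear_scaleC]) (simp add: scale)
  then show "bounded_clinear ?T"
    by (simp add: bounded_clinear_iff bounded_linear_sqrt_compl[OF lin Q_le])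
  have "cadjoint ?T h = ?T h" for h
    by (rule cadjoint_eqI, rule cinner_eq_if_inner_eq[where F = ?T])
       (simp_all only: sqrt_compl_selfadjoint[OF lin Q_le sa] scale_T)
  then show "V (cadjoint V h) + ?T (cadjoint ?T h) = h" for h
    using sqrt_compl_squared[OF lin Q_le, of h] by (simp add: Q_def[of h])
qed

text \<open>
  The adjoint \<open>h \<mapsto> (V\<^sup>* h, T\<^sup>* h)\<close> of the row is isometric, and an operator is contractive if its
  adjoint is; the Cauchy-Schwarz inequality in the product space expresses this.
\<close>

lemma coisometric_row_contractive:
  fixes V :: "'x::chilbert_space \<Rightarrow> 'h::chilbert_space" and T :: "'u::chilbert_space \<Rightarrow> 'h"
  assumes V: "bounded_clinear V" and T: "bounded_clinear T"
    and coiso: "\<And>h. V (cadjoint V h) + T (cadjoint T h) = h"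
  shows "(norm (V x + T u))\<^sup>2 \<le> (norm x)\<^sup>2 + (norm u)\<^sup>2"
proof -
  define h where "h = V x + T u"
  let ?k = "(cadjoint V h, cadjoint T h)"
  have pair: "inner (V v + T w) h = inner (v, w) ?k" for v w
    by (simp add: inner_add_left inner_cadjoint[OF V] inner_cadjoint[OF T])
  have "inner ?k ?k = inner h h"
    using pair[of "cadjoint V h" "cadjoint T h"] unfolding coiso by (rule sym)
  then have "norm ?k = norm h" by (simp only: norm_eq_sqrt_inner)
  then have "inner h h \<le> norm (x, u) * norm h"
    using pair[of x u] norm_cauchy_schwarz[of "(x, u)" ?k] unfolding h_def[symmetric] by metis
  then have "norm h * norm h \<le> norm (x, u) * norm h"
    by (simp only: power2_norm_eq_inner[symmetric] power2_eq_square)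
  then have "norm h \<le> norm (x, u)" by (cases "h = 0") auto
  then have "(norm h)\<^sup>2 \<le> (norm (x, u))\<^sup>2" by (intro power_mono) auto
  then show ?thesis by (simp add: h_def norm_Pair)
qed

section \<open>Sums over factorizations of a word\<close>

lemma sum_word_splits_Nil:
  "(\<Sum>(\<beta>, \<gamma>) | \<beta> @ \<gamma> = []. h \<beta> \<gamma>) = (h [] [] :: 'a::comm_monoid_add)"
proof -
  have "{(\<beta>, \<gamma>). \<beta> @ \<gamma> = []} = {([], [])}" by auto
  then show ?thesis by simp
qed

lemma sum_word_splits_Cons:
  "(\<Sum>(\<beta>, \<gamma>) | \<beta> @ \<gamma> = j # \<alpha>. h \<beta> \<gamma>)
     = h [] (j # \<alpha>) + (\<Sum>(\<beta>, \<gamma>) | \<beta> @ \<gamma> = \<alpha>. (h (j # \<beta>) \<gamma> :: 'a::comm_monoid_add))"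
proof -
  have eq: "{(\<beta>, \<gamma>). \<beta> @ \<gamma> = j # \<alpha>} =
      insert ([], j # \<alpha>) ((\<lambda>(\<beta>, \<gamma>). (j # \<beta>, \<gamma>)) ` {(\<beta>, \<gamma>). \<beta> @ \<gamma> = \<alpha>})"
    by (auto simp: append_eq_Cons_conv image_iff)
  have fin: "finite ((\<lambda>(\<beta>, \<gamma>). (j # \<beta>, \<gamma>)) ` {(\<beta>, \<gamma>). \<beta> @ \<gamma> = \<alpha>})"
    by (intro finite_imageI finite_word_splits)
  have "(\<Sum>(\<beta>, \<gamma>)\<in>(\<lambda>(\<beta>, \<gamma>). (j # \<beta>, \<gamma>)) ` {(\<beta>, \<gamma>). \<beta> @ \<gamma> = \<alpha>}. h \<beta> \<gamma>)
      = (\<Sum>(\<beta>, \<gamma>) | \<beta> @ \<gamma> = \<alpha>. h (j # \<beta>) \<gamma>)"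
    by (subst sum.reindex) (auto simp: inj_on_def intro!: sum.cong)
  then show ?thesis unfolding eq using fin by (subst sum.insert) auto
qed

lemma sum_word_splits_left:
  assumes "\<And>\<beta> \<gamma>. \<beta> \<noteq> [] \<Longrightarrow> h \<beta> \<gamma> = 0"
  shows "(\<Sum>(\<beta>, \<gamma>) | \<beta> @ \<gamma> = \<alpha>. h \<beta> \<gamma>) = (h [] \<alpha> :: 'a::comm_monoid_add)"
proof -
  have "(\<Sum>(\<beta>, \<gamma>) | \<beta> @ \<gamma> = \<alpha>. h \<beta> \<gamma>) = (\<Sum>(\<beta>, \<gamma>)\<in>{([], \<alpha>)}. h \<beta> \<gamma>)"
    using assms by (intro sum.mono_neutral_right) (auto simp: finite_word_splits)
  then show ?thesis by simp
qed

lemma sum_word_splits_right: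
  assumes "\<And>\<beta> \<gamma>. \<gamma> \<noteq> [] \<Longrightarrow> h \<beta> \<gamma> = 0"
  shows "(\<Sum>(\<beta>, \<gamma>) | \<beta> @ \<gamma> = \<alpha>. h \<beta> \<gamma>) = (h \<alpha> [] :: 'a::comm_monoid_add)"
proof -
  have "(\<Sum>(\<beta>, \<gamma>) | \<beta> @ \<gamma> = \<alpha>. h \<beta> \<gamma>) = (\<Sum>(\<beta>, \<gamma>)\<in>{(\<alpha>, [])}. h \<beta> \<gamma>)"
    using assms by (intro sum.mono_neutral_right) (auto simp: finite_word_splits)
  then show ?thesis by simp
qed

lemma sum_word_splits_snoc:
  "(\<Sum>(\<beta>, \<gamma>) | \<beta> @ \<gamma> = \<alpha> @ [i]. h \<beta> \<gamma>)
     = h (\<alpha> @ [i]) [] + (\<Sum>(\<beta>, \<gamma>) | \<beta> @ \<gamma> = \<alpha>. (h \<beta> (\<gamma> @ [i]) :: 'a::comm_monoid_add))"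
proof -
  have eq: "{(\<beta>, \<gamma>). \<beta> @ \<gamma> = \<alpha> @ [i]} =
      insert (\<alpha> @ [i], []) ((\<lambda>(\<beta>, \<gamma>). (\<beta>, \<gamma> @ [i])) ` {(\<beta>, \<gamma>). \<beta> @ \<gamma> = \<alpha>})"
  proof -
    have "(\<beta>, \<gamma>) \<in> insert (\<alpha> @ [i], []) ((\<lambda>(\<beta>, \<gamma>). (\<beta>, \<gamma> @ [i])) ` {(\<beta>, \<gamma>). \<beta> @ \<gamma> = \<alpha>})"
      if "\<beta> @ \<gamma> = \<alpha> @ [i]" for \<beta> \<gamma>
      using that by (cases \<gamma> rule: rev_cases) (auto simp: image_iff)
    then have "{(\<beta>, \<gamma>). \<beta> @ \<gamma> = \<alpha> @ [i]} \<subseteq>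
        insert (\<alpha> @ [i], []) ((\<lambda>(\<beta>, \<gamma>). (\<beta>, \<gamma> @ [i])) ` {(\<beta>, \<gamma>). \<beta> @ \<gamma> = \<alpha>})"
      by blast
    then show ?thesis by (intro equalityI) auto
  qed
  have fin: "finite ((\<lambda>(\<beta>, \<gamma>). (\<beta>, \<gamma> @ [i])) ` {(\<beta>, \<gamma>). \<beta> @ \<gamma> = \<alpha>})"
    by (intro finite_imageI finite_word_splits)
  have "(\<Sum>(\<beta>, \<gamma>)\<in>(\<lambda>(\<beta>, \<gamma>). (\<beta>, \<gamma> @ [i])) ` {(\<beta>, \<gamma>). \<beta> @ \<gamma> = \<alpha>}. h \<beta> \<gamma>)
      = (\<Sum>(\<beta>, \<gamma>) | \<beta> @ \<gamma> = \<alpha>. h \<beta> (\<gamma> @ [i]))"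
    by (subst sum.reindex) (auto simp: inj_on_def intro!: sum.cong)
  then show ?thesis unfolding eq using fin by (subst sum.insert) auto
qed

section \<open>The kernel of a power series\<close>

lemma series2_mult_in_z:
  "series2_mult (in_z S) G \<alpha> \<beta> x = (\<Sum>(\<alpha>1, \<alpha>2) | \<alpha>1 @ \<alpha>2 = \<alpha>. S \<alpha>1 (G \<alpha>2 \<beta> x))"
  unfolding series2_mult_def
  by (intro sum.cong refl) (clarsimp, subst sum_word_splits_left, simp_all add: in_z_def)

lemma series2_mult_adj_in_w:
  assumes "\<And>\<alpha> \<beta>. F \<alpha> \<beta> 0 = 0"
  shows "series2_mult F (adj_in_w U S) \<alpha> \<beta> y
    = (\<Sum>(\<beta>1, \<beta>2) | \<beta>1 @ \<beta>2 = \<beta>. F \<alpha> \<beta>1 (cadjoint_on U (S (rev \<beta>2)) y))"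
  unfolding series2_mult_def
  by (subst sum_word_splits_right) (simp_all add: adj_in_w_def assms case_prod_unfold)

text \<open>
  The coefficient of \<open>S(z) k\<^sub>S\<^sub>z(z, w)\<close> at \<open>(\<alpha>, \<beta>)\<close> is \<open>S \<alpha>'\<close> if \<open>\<alpha> = \<alpha>' rev \<beta>\<close>, and \<open>0\<close> if
  \<open>rev \<beta>\<close> is not a suffix of \<open>\<alpha>\<close>. The next lemmas express this as a recursion on the last letter of
  \<open>\<alpha>\<close> and the first letter of \<open>\<beta>\<close>, which is passed on to the kernel.
\<close>

context
  fixes U :: "'u::chilbert_space set" and S :: "'d word \<Rightarrow> 'u \<Rightarrow> 'y::chilbert_space"
  assumes S_zero: "\<And>\<alpha>. S \<alpha> 0 = 0"
begin

lemma in_z_szego_zero: "series2_mult (in_z S) szego \<alpha> \<beta> 0 = 0"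
  by (simp add: series2_mult_in_z szego_def S_zero case_prod_unfold)

lemma in_z_szego_Nil: "series2_mult (in_z S) szego \<alpha> [] u = S \<alpha> u"
  unfolding series2_mult_in_z by (subst sum_word_splits_right) (simp_all add: szego_def S_zero)

lemma in_z_szego_Nil_Cons: "series2_mult (in_z S) szego [] (j # \<beta>) u = 0"
  by (simp add: series2_mult_in_z sum_word_splits_Nil szego_def S_zero)

lemma in_z_szego_snoc_Cons:
  "series2_mult (in_z S) szego (\<alpha> @ [i]) (j # \<beta>) u
     = (if i = j then series2_mult (in_z S) szego \<alpha> \<beta> u else 0)"
  unfolding series2_mult_in_z
  by (subst sum_word_splits_snoc) (auto simp: szego_def S_zero case_prod_unfold intro!: sum.cong)

lemma K_Schur_Nil_right:
  "K_Schur U S \<alpha> [] y = (if \<alpha> = [] then y else 0) - S \<alpha> (cadjoint_on U (S []) y)"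
  by (auto simp: K_Schur_def series2_mult_adj_in_w in_z_szego_zero in_z_szego_Nil
      sum_word_splits_Nil szego_def)

lemma K_Schur_Nil_left:
  "K_Schur U S [] \<beta> y = (if \<beta> = [] then y else 0) - S [] (cadjoint_on U (S (rev \<beta>)) y)"
proof -
  have "(\<Sum>(\<beta>1, \<beta>2) | \<beta>1 @ \<beta>2 = \<beta>.
      series2_mult (in_z S) szego [] \<beta>1 (cadjoint_on U (S (rev \<beta>2)) y))
    = S [] (cadjoint_on U (S (rev \<beta>)) y)"
    by (subst sum_word_splits_left) (auto simp: neq_Nil_conv in_z_szego_Nil_Cons in_z_szego_Nil)
  then show ?thesis
    by (simp add: K_Schur_def series2_mult_adj_in_w in_z_szego_zero szego_def)
qed

lemma K_Schur_snoc_Cons: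
  "K_Schur U S (\<alpha> @ [i]) (j # \<beta>) y
     = (if i = j then K_Schur U S \<alpha> \<beta> y else 0)
       - S (\<alpha> @ [i]) (cadjoint_on U (S (rev \<beta> @ [j])) y)"
  by (auto simp: K_Schur_def series2_mult_adj_in_w in_z_szego_zero sum_word_splits_Cons
      in_z_szego_Nil in_z_szego_snoc_Cons szego_def)

end

section \<open>Realization of the kernel of an output pair\<close>

lemma op_power_Nil [simp]: "op_power A [] = id"
  by (simp add: op_power_def)

lemma op_power_Cons [simp]: "op_power A (j # \<alpha>) = (\<lambda>x. A j (op_power A \<alpha> x))"
  by (simp add: op_power_def comp_def)

lemma op_power_snoc: "op_power A (\<alpha> @ [j]) x = op_power A \<alpha> (A j x)"
  by (induction \<alpha>) auto

lemma bounded_clinear_op_power: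
  "(\<And>j. bounded_clinear (A j)) \<Longrightarrow> bounded_clinear (op_power A \<alpha>)"
proof (induction \<alpha>)
  case Nil
  show ?case by (auto simp: bounded_clinear_on_def intro: exI[of _ 1])
qed (simp add: bounded_clinear_compose[of "A _"])

text \<open>
  \<open>output_column\<close> is the operator \<open>V\<close> of the introduction and \<open>output_coeff\<close> the map \<open>R\<^sub>\<alpha>\<close>. The
  coefficients of \<open>(I - Z(z) A)\<^sup>-\<^sup>1 Z(z)\<close>, acting on the first component of \<open>h\<close>, are \<open>state_coeff\<close>;
  this series has no constant term, hence the value \<open>0\<close> at the empty word.
\<close>

definition output_column ::
    "('x \<Rightarrow> 'y) \<Rightarrow> ('d::finite \<Rightarrow> 'x \<Rightarrow> 'x) \<Rightarrow> 'x \<Rightarrow> ('x ^ 'd) \<times> 'y" where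
  "output_column C A x = (\<chi> j. A j x, C x)"

definition state_coeff :: "('d::finite \<Rightarrow> 'x \<Rightarrow> 'x) \<Rightarrow> 'd word \<Rightarrow> ('x::zero ^ 'd) \<times> 'y \<Rightarrow> 'x" where
  "state_coeff A \<alpha> h = (if \<alpha> = [] then 0 else op_power A (butlast \<alpha>) (fst h $ last \<alpha>))"

definition output_coeff ::
    "('x \<Rightarrow> 'y) \<Rightarrow> ('d::finite \<Rightarrow> 'x \<Rightarrow> 'x) \<Rightarrow> 'd word \<Rightarrow> ('x ^ 'd) \<times> 'y \<Rightarrow> 'y" where
  "output_coeff C A \<alpha> h = (if \<alpha> = [] then snd h else C (op_power A (butlast \<alpha>) (fst h $ last \<alpha>)))"

lemma output_coeff_Nil [simp]: "output_coeff C A [] h = snd h"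
  by (simp add: output_coeff_def)

lemma output_coeff_snoc [simp]: "output_coeff C A (\<alpha> @ [j]) h = C (op_power A \<alpha> (fst h $ j))"
  by (simp add: output_coeff_def)

text \<open>
  The last letter of \<open>\<alpha>\<close> selects the component of \<open>V x\<close>, which applies exactly that letter of
  \<open>A\<^sup>\<alpha>\<close> to \<open>x\<close>.
\<close>

lemma output_coeff_output_column:
  "output_coeff C A \<alpha> (output_column C A x) = C (op_power A \<alpha> x)"
  by (cases \<alpha> rule: rev_cases) (simp_all add: output_column_def op_power_snoc)

lemma bounded_linear_vec_lambda:
  fixes F :: "'d::finite \<Rightarrow> 'x::real_normed_vector \<Rightarrow> 'y::real_normed_vector"
  assumes "\<And>j. bounded_linear (F j)"
  shows "bounded_linear (\<lambda>x. \<chi> j. F j x)"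
proof -
  interpret bounded_linear "F j" for j by fact
  obtain B where B: "\<And>j x. norm (F j x) \<le> norm x * B j" using bounded by metis
  show ?thesis
  proof (rule bounded_linear_intro[where K = "\<Sum>j\<in>UNIV. B j"])
    fix x
    have "norm (\<chi> j. F j x) \<le> (\<Sum>j\<in>UNIV. norm (F j x))"
      unfolding norm_vec_def by (rule order_trans[OF L2_set_le_sum]) simp_all
    also have "\<dots> \<le> norm x * (\<Sum>j\<in>UNIV. B j)"
      unfolding sum_distrib_left by (intro sum_mono B)
    finally show "norm (\<chi> j. F j x) \<le> norm x * (\<Sum>j\<in>UNIV. B j)" .
  qed (simp_all add: vec_eq_iff add scaleR)
qed

context
  fixes C :: "'x::chilbert_space \<Rightarrow> 'y::chilbert_space" and A :: "'d::finite \<Rightarrow> 'x \<Rightarrow> 'x"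
  assumes pair: "output_pair C A"
begin

lemma bounded_clinear_C: "bounded_clinear C" and bounded_clinear_A: "bounded_clinear (A j)"
  using pair by (auto simp: output_pair_def)

lemma bounded_clinear_C_op_power: "bounded_clinear (\<lambda>x. C (op_power A \<alpha> x))"
  by (rule bounded_clinear_compose[OF bounded_clinear_C
        bounded_clinear_op_power[of A, OF bounded_clinear_A]])

lemma bounded_clinear_output_column: "bounded_clinear (output_column C A)"
proof -
  have "bounded_linear C" "\<And>j. bounded_linear (A j)"
    using bounded_clinear_C bounded_clinear_A by (auto simp: bounded_clinear_iff)
  then have "bounded_linear (output_column C A)"
    unfolding output_column_def
    by (intro bounded_linear_Pair bounded_linear_vec_lambda)
  moreover have "output_column C A (c *\<^sub>C x) = c *\<^sub>C output_column C A x" for c x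
    using bounded_clinear_C bounded_clinear_A
    by (simp add: output_column_def scaleC_prod_def scaleC_vec_def bounded_clinear_iff vec_eq_iff)
  ultimately show ?thesis by (simp add: bounded_clinear_iff)
qed

lemma bounded_clinear_output_coeff: "bounded_clinear (output_coeff C A \<alpha>)"
proof (cases \<alpha> rule: rev_cases)
  case Nil
  then show ?thesis
    by (simp add: bounded_clinear_iff output_coeff_def[abs_def] scaleC_prod_def bounded_linear_snd)
next
  case (snoc \<alpha>' j)
  have "bounded_clinear (\<lambda>h :: ('x ^ 'd) \<times> 'y. fst h $ j)"
    using bounded_linear_compose[OF bounded_linear_vec_nth bounded_linear_fst]
    by (simp add: bounded_clinear_iff scaleC_prod_def scaleC_vec_def)
  from bounded_clinear_compose[OF bounded_clinear_C_op_power[of \<alpha>'] this]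
  have "bounded_clinear (\<lambda>h :: ('x ^ 'd) \<times> 'y. C (op_power A \<alpha>' (fst h $ j)))" .
  then show ?thesis by (simp add: snoc output_coeff_def[abs_def])
qed

lemma cadjoint_C_op_power:
  "cadjoint (\<lambda>x. C (op_power A \<alpha> x)) y = cadjoint (op_power A \<alpha>) (cadjoint C y)"
  by (intro cadjoint_compose bounded_clinear_C bounded_clinear_op_power bounded_clinear_A)

lemma cadjoint_output_coeff_Nil: "cadjoint (output_coeff C A []) y = (0, y)"
  by (rule cadjoint_eqI) (simp add: cinner_prod_def cinner_zero_right)

lemma cadjoint_output_coeff_snoc:
  "cadjoint (output_coeff C A (\<alpha> @ [j])) y
     = (axis j (cadjoint (op_power A \<alpha>) (cadjoint C y)), 0)"
proof (rule cadjoint_eqI)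
  fix h :: "('x ^ 'd) \<times> 'y"
  let ?x = "cadjoint (op_power A \<alpha>) (cadjoint C y)"
  have "cinner (fst h) (axis j ?x) = (\<Sum>i\<in>UNIV. if i = j then cinner (fst h $ i) ?x else 0)"
    unfolding cinner_vec_def by (intro sum.cong) (auto simp: axis_def cinner_zero_right)
  then show "cinner (output_coeff C A (\<alpha> @ [j]) h) y = cinner h (axis j ?x, 0)"
    using cinner_cadjoint[OF bounded_clinear_C_op_power, of \<alpha> "fst h $ j" y]
    by (simp add: cinner_prod_def cinner_zero_right cadjoint_C_op_power)
qed

text \<open>
  Applying \<open>R\<^sub>\<alpha>\<close> to the coisometry equation at \<open>R\<^sub>\<gamma>\<^sup>* y\<close> expresses \<open>S\<^sub>\<alpha> S\<^sub>\<gamma>\<^sup>*\<close> by the kernel of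
  the pair. Inserted into the recursion for \<open>K_Schur\<close>, it gives the identity by induction, since
  \<open>R\<^sub>\<alpha> R\<^sub>\<gamma>\<^sup>*\<close> removes a common last letter and is zero if the last letters differ.
\<close>

lemma K_Schur_eq_K_output:
  fixes T :: "'u::chilbert_space \<Rightarrow> ('x ^ 'd) \<times> 'y"
  assumes T: "bounded_clinear T"
    and coiso: "\<And>h. output_column C A (cadjoint (output_column C A) h) + T (cadjoint T h) = h"
  shows "K_Schur UNIV (\<lambda>\<alpha> u. output_coeff C A \<alpha> (T u)) = K_output C A"
proof -
  define V where "V = output_column C A"
  define R where "R = output_coeff C A"
  define S where "S = (\<lambda>\<alpha> u. R \<alpha> (T u))"
  have V: "bounded_clinear V" unfolding V_def by (rule bounded_clinear_output_column)
  have R: "bounded_clinear (R \<alpha>)" for \<alpha> unfolding R_def by (rule bounded_clinear_output_coeff)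
  have "bounded_clinear (S \<alpha>)" for \<alpha> unfolding S_def by (rule bounded_clinear_compose[OF R T])
  then have S_zero: "S \<alpha> 0 = 0" for \<alpha> by (rule bounded_clinear_zero)
  have RV: "(\<lambda>x. R \<alpha> (V x)) = (\<lambda>x. C (op_power A \<alpha> x))" for \<alpha>
    by (simp add: R_def V_def output_coeff_output_column)
  \<comment> \<open>The coisometry equation between \<open>R \<alpha>\<close> and the adjoint of \<open>R \<gamma>\<close>.\<close>
  have SS: "S \<alpha> (cadjoint (S \<gamma>) y) = R \<alpha> (cadjoint (R \<gamma>) y) - K_output C A \<alpha> (rev \<gamma>) y" for \<alpha> \<gamma> y
  proof -
    interpret R: bounded_linear "R \<alpha>" using R by (simp add: bounded_clinear_iff)
    let ?h = "cadjoint (R \<gamma>) y"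
    have "R \<alpha> ?h = R \<alpha> (V (cadjoint V ?h)) + R \<alpha> (T (cadjoint T ?h))"
      using coiso[of ?h] by (simp add: V_def R.add[symmetric])
    also have "R \<alpha> (T (cadjoint T ?h)) = S \<alpha> (cadjoint (S \<gamma>) y)"
      by (simp add: S_def cadjoint_compose[OF R T])
    also have "R \<alpha> (V (cadjoint V ?h)) = K_output C A \<alpha> (rev \<gamma>) y"
      using fun_cong[OF RV[of \<alpha>]] cadjoint_compose[OF R V, of \<gamma> y]
      by (simp add: RV cadjoint_C_op_power K_output_def)
    finally show ?thesis by simp
  qed
  have "K_Schur UNIV S \<alpha> (rev \<gamma>) y = K_output C A \<alpha> (rev \<gamma>) y" for \<alpha> \<gamma> y
  proof (induction \<alpha> arbitrary: \<gamma> rule: rev_induct)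
    case Nil
    have "R [] (cadjoint (R \<gamma>) y) = (if \<gamma> = [] then y else 0)"
      by (cases \<gamma> rule: rev_cases)
         (simp_all add: R_def cadjoint_output_coeff_Nil cadjoint_output_coeff_snoc)
    then show ?case by (simp add: K_Schur_Nil_left[where S = S, OF S_zero] SS)
  next
    case (snoc i \<alpha>)
    show ?case
    proof (cases \<gamma> rule: rev_cases)
      case Nil
      have "R (\<alpha> @ [i]) (cadjoint (R []) y) = C (op_power A \<alpha> 0)"
        by (simp add: R_def cadjoint_output_coeff_Nil)
      also have "\<dots> = 0"
        by (rule bounded_clinear_zero[OF bounded_clinear_C_op_power])
      finally show ?thesis by (simp add: Nil K_Schur_Nil_right[where S = S, OF S_zero] SS)
    next
      case (snoc \<gamma>' j)
      have "R (\<alpha> @ [i]) (cadjoint (R (\<gamma>' @ [j])) y)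
          = (if i = j then K_output C A \<alpha> (rev \<gamma>') y else C (op_power A \<alpha> 0))"
        by (simp add: R_def cadjoint_output_coeff_snoc K_output_def axis_def)
      also have "C (op_power A \<alpha> 0) = 0"
        by (rule bounded_clinear_zero[OF bounded_clinear_C_op_power])
      finally show ?thesis
        using SS[of "\<alpha> @ [i]" "\<gamma>' @ [j]" y] snoc.IH[of \<gamma>']
        by (simp add: \<open>\<gamma> = \<gamma>' @ [j]\<close> K_Schur_snoc_Cons[where S = S, OF S_zero])
    qed
  qed
  then have "K_Schur UNIV S \<alpha> \<beta> y = K_output C A \<alpha> \<beta> y" for \<alpha> \<beta> y
    using rev_rev_ident[of \<beta>] by metis
  then show ?thesis by (intro ext) (simp add: S_def R_def)
qed

section \<open>Energy balance\<close>

text \<open>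
  Removing the first letter turns the convolution with \<open>state_coeff\<close> into the state recursion of the
  system: the summand for the empty word is the fresh input.
\<close>

lemma state_coeff_Cons:
  "state_coeff A (j # \<alpha>) h = A j (state_coeff A \<alpha> h) + (if \<alpha> = [] then fst h $ j else 0)"
  by (simp add: state_coeff_def bounded_clinear_zero[OF bounded_clinear_A])

lemma output_coeff_eq_state_coeff:
  "output_coeff C A \<alpha> h = C (state_coeff A \<alpha> h) + (if \<alpha> = [] then snd h else 0)"
  by (simp add: state_coeff_def output_coeff_def bounded_clinear_zero[OF bounded_clinear_C])

end

text \<open>
  Here \<open>e\<close>, \<open>f\<close> and \<open>g\<close> are the energies of state, input and output. Summed over all words of length
  less than \<open>n\<close>, the local inequalities telescope, because the words of length \<open>n + 1\<close> are those of
  length \<open>n\<close> extended by a first letter.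
\<close>

lemma energy_dissipation:
  fixes e f g :: "'d::finite word \<Rightarrow> real"
  assumes e0: "e [] = 0" and nonneg: "\<And>\<alpha>. 0 \<le> e \<alpha>" "\<And>\<alpha>. 0 \<le> g \<alpha>" "\<And>\<alpha>. 0 \<le> f \<alpha>"
    and step: "\<And>\<alpha>. (\<Sum>j\<in>UNIV. e (j # \<alpha>)) + g \<alpha> \<le> e \<alpha> + f \<alpha>"
    and f: "f summable_on UNIV"
  shows "g summable_on UNIV" and "infsum g UNIV \<le> infsum f UNIV"
proof -
  have finL: "finite {\<alpha> :: 'd word. length \<alpha> = n}" for n
    using finite_lists_length_eq[of "UNIV :: 'd set" n] by simp
  have fin: "finite {\<alpha> :: 'd word. length \<alpha> < n}" for n
    by (rule finite_subset[OF _ finite_lists_length_le[of "UNIV :: 'd set" n]]) auto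
  have split: "{\<alpha> :: 'd word. length \<alpha> < Suc n} = {\<alpha>. length \<alpha> < n} \<union> {\<alpha>. length \<alpha> = n}" for n
    by auto
  have sum_split: "sum h {\<alpha>. length \<alpha> < Suc n} = sum h {\<alpha>. length \<alpha> < n} + sum h {\<alpha>. length \<alpha> = n}"
    for h :: "'d word \<Rightarrow> real" and n
    unfolding split using fin finL by (subst sum.union_disjoint) auto
  have balance: "sum g {\<alpha>. length \<alpha> < n} + sum e {\<alpha>. length \<alpha> = n} \<le> sum f {\<alpha>. length \<alpha> < n}" for n
  proof (induction n)
    case 0
    then show ?case by (simp add: e0)
  next
    case (Suc n)
    have "sum e {\<alpha>. length \<alpha> = Suc n} = (\<Sum>(\<alpha>, j)\<in>{\<alpha>. length \<alpha> = n} \<times> UNIV. e (j # \<alpha>))"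
      by (rule sum.reindex_bij_witness[where i = "\<lambda>(\<alpha>, j). j # \<alpha>" and j = "\<lambda>\<alpha>. (tl \<alpha>, hd \<alpha>)"])
         (auto simp: length_Suc_conv)
    also have "\<dots> = (\<Sum>\<alpha> | length \<alpha> = n. \<Sum>j\<in>UNIV. e (j # \<alpha>))"
      by (simp add: sum.cartesian_product)
    finally have "sum g {\<alpha>. length \<alpha> = n} + sum e {\<alpha>. length \<alpha> = Suc n}
        = (\<Sum>\<alpha> | length \<alpha> = n. (\<Sum>j\<in>UNIV. e (j # \<alpha>)) + g \<alpha>)"
      by (simp add: sum.distrib)
    also have "\<dots> \<le> (\<Sum>\<alpha> | length \<alpha> = n. e \<alpha> + f \<alpha>)" by (rule sum_mono) (rule step)
    finally show ?case using Suc by (simp add: sum_split sum.distrib)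
  qed
  have bound: "sum g F \<le> infsum f UNIV" if "finite F" for F
  proof -
    let ?n = "Suc (Max (insert 0 (length ` F)))"
    have e_pos: "0 \<le> sum e {\<alpha>. length \<alpha> = ?n}" by (intro sum_nonneg nonneg)
    have "F \<subseteq> {\<alpha>. length \<alpha> < ?n}" using that by (auto simp: less_Suc_eq_le intro!: Max_ge)
    then have "sum g F \<le> sum g {\<alpha>. length \<alpha> < ?n}" using fin nonneg by (intro sum_mono2) auto
    also have "\<dots> \<le> sum f {\<alpha>. length \<alpha> < ?n}" using balance[of ?n] e_pos by linarith
    also have "\<dots> \<le> infsum f UNIV" using fin f nonneg by (intro finite_sum_le_infsum) auto
    finally show ?thesis .
  qed
  then show g: "g summable_on UNIV"
    using nonneg by (intro nonneg_bdd_above_summable_on bdd_aboveI[where M = "infsum f UNIV"]) auto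
  show "infsum g UNIV \<le> infsum f UNIV" using g bound by (intro infsum_le_finite_sums) auto
qed

text \<open>
  The output of the system is the product \<open>S f\<close>: both the state and the output at a word are
  convolutions of the input, and contractivity of the row at each word is the local energy inequality.
\<close>

lemma output_coeff_schur_class:
  fixes C :: "'x::chilbert_space \<Rightarrow> 'y::chilbert_space" and A :: "'d::finite \<Rightarrow> 'x \<Rightarrow> 'x"
    and T :: "'u::chilbert_space \<Rightarrow> ('x ^ 'd) \<times> 'y"
  assumes pair: "output_pair C A" and T: "bounded_clinear T"
    and contr: "\<And>x u. (norm (output_column C A x + T u))\<^sup>2 \<le> (norm x)\<^sup>2 + (norm u)\<^sup>2"
  shows "(\<lambda>\<alpha> u. output_coeff C A \<alpha> (T u)) \<in> schur_class UNIV"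
proof -
  define S where "S = (\<lambda>\<alpha> u. output_coeff C A \<alpha> (T u))"
  have S: "bounded_clinear (S \<alpha>)" for \<alpha>
    unfolding S_def by (rule bounded_clinear_compose[OF bounded_clinear_output_coeff[OF pair] T])
  have "series_apply S f \<in> H2 UNIV \<and> H2_norm (series_apply S f) \<le> H2_norm f"
    if f: "f \<in> H2 UNIV" for f :: "'d word \<Rightarrow> 'u"
  proof -
    define x where "x = series_apply (\<lambda>\<alpha> u. state_coeff A \<alpha> (T u)) f"
    define g where "g = series_apply S f"
    have lin: "linear C" "\<And>j. linear (A j)"
      using pair by (auto simp: output_pair_def bounded_clinear_iff bounded_linear.linear)
    have x_Nil: "x [] = 0"
      by (simp add: x_def series_apply_def sum_word_splits_Nil state_coeff_def)
    have if_first: "(\<Sum>(\<beta>, \<gamma>) | \<beta> @ \<gamma> = \<alpha>. if \<beta> = [] then q (f \<gamma>) else 0) = q (f \<alpha>)"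
      for \<alpha> and q :: "'u \<Rightarrow> 'z::comm_monoid_add"
      by (subst sum_word_splits_left) auto
    have x_Cons: "x (j # \<alpha>) = A j (x \<alpha>) + fst (T (f \<alpha>)) $ j" for j \<alpha>
    proof -
      have "x (j # \<alpha>) = (\<Sum>(\<beta>, \<gamma>) | \<beta> @ \<gamma> = \<alpha>. A j (state_coeff A \<beta> (T (f \<gamma>)))
                             + (if \<beta> = [] then fst (T (f \<gamma>)) $ j else 0))"
        by (simp add: x_def series_apply_def sum_word_splits_Cons state_coeff_Cons[OF pair])
           (simp add: state_coeff_def)
      then show ?thesis
        using if_first[of "\<lambda>u. fst (T u) $ j" \<alpha>]
        by (simp add: case_prod_unfold sum.distrib linear_sum[OF lin(2)] x_def series_apply_def)
    qed
    have g: "g \<alpha> = C (x \<alpha>) + snd (T (f \<alpha>))" for \<alpha>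
      using if_first[of "\<lambda>u. snd (T u)" \<alpha>]
      by (simp add: g_def S_def series_apply_def output_coeff_eq_state_coeff[OF pair]
          case_prod_unfold sum.distrib linear_sum[OF lin(1)] x_def)
    \<comment> \<open>The new states and the output together form the image of \<open>(x \<alpha>, f \<alpha>)\<close> under the row.\<close>
    have step: "(\<Sum>j\<in>UNIV. (norm (x (j # \<alpha>)))\<^sup>2) + (norm (g \<alpha>))\<^sup>2 \<le> (norm (x \<alpha>))\<^sup>2 + (norm (f \<alpha>))\<^sup>2"
      for \<alpha>
    proof -
      have "output_column C A (x \<alpha>) + T (f \<alpha>) = (\<chi> j. x (j # \<alpha>), g \<alpha>)"
        by (simp add: output_column_def x_Cons g prod_eq_iff vec_eq_iff)
      then show ?thesis
        using contr[of "x \<alpha>" "f \<alpha>"]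
        by (simp add: norm_Pair norm_vec_def L2_set_def sum_nonneg)
    qed
    have f_sum: "(\<lambda>\<alpha>. (norm (f \<alpha>))\<^sup>2) summable_on UNIV" using f by (simp add: H2_def)
    have "(\<lambda>\<alpha>. (norm (g \<alpha>))\<^sup>2) summable_on UNIV"
      "(\<Sum>\<^sub>\<infinity>\<alpha>. (norm (g \<alpha>))\<^sup>2) \<le> (\<Sum>\<^sub>\<infinity>\<alpha>. (norm (f \<alpha>))\<^sup>2)"
      by (rule energy_dissipation[where e = "\<lambda>\<alpha>. (norm (x \<alpha>))\<^sup>2" and f = "\<lambda>\<alpha>. (norm (f \<alpha>))\<^sup>2"];
          simp add: x_Nil step f_sum)+
    then show ?thesis by (simp add: H2_def H2_norm_def g_def)
  qed
  then show ?thesis using S by (simp add: schur_class_def S_def)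
qed

lemma norm_output_column_le:
  assumes "contractive_pair C A"
  shows "norm (output_column C A x) \<le> norm x"
proof -
  have C: "bounded_clinear C" and A: "\<And>j. bounded_clinear (A j)"
    and le: "loewner_le (\<lambda>x. (\<Sum>j\<in>UNIV. cadjoint (A j) (A j x)) + cadjoint C (C x)) (\<lambda>x. x)"
    using assms by (auto simp: contractive_pair_def output_pair_def)
  have "0 \<le> inner (x - ((\<Sum>j\<in>UNIV. cadjoint (A j) (A j x)) + cadjoint C (C x))) x"
    using le[unfolded loewner_le_def, rule_format, of x]
    by (simp add: inner_eq_Re_cinner complex_nonneg_Reals_iff)
  also have "\<dots> = inner x (x - ((\<Sum>j\<in>UNIV. cadjoint (A j) (A j x)) + cadjoint C (C x)))"
    by (rule inner_commute)
  also have "\<dots> = (norm x)\<^sup>2 - (\<Sum>j\<in>UNIV. (norm (A j x))\<^sup>2) - (norm (C x))\<^sup>2"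
    by (simp add: inner_diff_right inner_add_right inner_sum_right
        inner_cadjoint[OF C, symmetric] inner_cadjoint[OF A, symmetric] power2_norm_eq_inner)
  finally have "(norm (output_column C A x))\<^sup>2 \<le> (norm x)\<^sup>2"
    by (simp add: output_column_def norm_Pair norm_vec_def L2_set_def sum_nonneg)
  then show ?thesis by (rule power2_le_imp_le) simp
qed

theorem theorem3p5:
  fixes C :: "'x::chilbert_space \<Rightarrow> 'y::chilbert_space"
    and A :: "'d::finite \<Rightarrow> 'x \<Rightarrow> 'x"
  assumes "contractive_pair C A"
  shows "\<exists>(U :: (('x ^ 'd) \<times> 'y) set) S.
           closed_csubspace U \<and> S \<in> schur_class U \<and> K_Schur U S = K_output C A"
proof -
  have pair: "output_pair C A" using assms by (simp add: contractive_pair_def)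
  note V = bounded_clinear_output_column[OF pair]
  obtain T :: "('x ^ 'd) \<times> 'y \<Rightarrow> ('x ^ 'd) \<times> 'y" where T: "bounded_clinear T"
    and coiso: "\<And>h. output_column C A (cadjoint (output_column C A) h) + T (cadjoint T h) = h"
    using coisometric_completion[OF V norm_output_column_le[OF assms]] by blast
  have "(\<lambda>\<alpha> u. output_coeff C A \<alpha> (T u)) \<in> schur_class UNIV"
    by (intro output_coeff_schur_class[OF pair T] coisometric_row_contractive[OF V T coiso])
  moreover have "closed_csubspace (UNIV :: (('x ^ 'd) \<times> 'y) set)"
    by (simp add: closed_csubspace_def)
  ultimately show ?thesis
    using K_Schur_eq_K_output[OF pair T coiso] by (intro exI conjI)
qed

end
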